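(* Let $\mathcal{U}$ be a finite set of unification equations and $\Theta$ a substitution schema. Then the $\Theta$-unification procedure applied to the initial configuration $(\emptyset,\mathcal{U})$ terminates after finitely many steps.
   Context: Variables are objects $X_i$ with $X$ from a countably infinite set $\mathcal{V}_{sym}$ of variable symbols and $i\in\mathbb{N}$; terms are first-order terms over a signature $\Sigma$ and these variables; $\mathrm{cls}(X_i)=\{X\}$. $\mathrm{shift}_d$ adds $d$ to every variable index in a term. A substitution schema $\Theta$ is given by pairwise distinct symbols $X^1,\dots,X^n$ and terms $t_1,\dots,t_n$, and is the infinite mapping $\{X^i_j\mapsto\mathrm{shift}_j(t_i)\mid 1\le i\le n, j\ge0\}$, with $\mathrm{dom}(\Theta)=\{X^1,\dots,X^n\}$. For a variable $x$ write $x\in\Theta$ if $\mathrm{cls}(x)\subseteq\mathrm{dom}(\Theta)$, and $x\notin\Theta$ otherwise. For a term $t$, $\Theta^t$ is the substitution sending each variable $x$ of $t$ with $x\in\Theta$ to its image under $\Theta$ and fixing all other variables; $\Theta^t(0)=t$ and $\Theta^t(k+1)=s\Theta^s$ with $s=\Theta^t(k)$. $\Theta$-unification. A configuration is a pair $(\mathcal{S},\mathcal{U})$ of sets of equations $s\stackrel{?}{=}t$ (the store and the active set). Starting from $(\emptyset,\mathcal{U})$, the procedure first saturates the active set under the rules: Decomposition (replace $f(r_1,\dots,r_n)\stackrel{?}{=}f(s_1,\dots,s_n)$ by the equations $r_i\stackrel{?}{=}s_i$); Orient-1 (replace $r\stackrel{?}{=}x$, $x$ a variable and $r$ not a variable,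 by $x\stackrel{?}{=}r$); Orient-2 (for variables $x,y$, if $y\stackrel{?}{=}x$ is present and $x\stackrel{?}{=}y$ is not, add $x\stackrel{?}{=}y$); Transitivity (if $x\stackrel{?}{=}r$ and $x\stackrel{?}{=}s$ are present with $x$ a variable and $r\neq s$, add $r\stackrel{?}{=}s$); Reflexive (remove $t\stackrel{?}{=}t$); Clash (if an equation between two non-variable terms with different head symbols arises, the procedure fails); each rule instance is applied only while it produces new equations. Then the rule Store is applied as long as possible: it moves an equation $y\stackrel{?}{=}r$ with $y$ a variable from the active set to the store provided (1) $y\in\Theta$ and, if $r$ is a variable, $r\in\Theta$; or (2) $y\notin\Theta$ and there is $x\stackrel{?}{=}s'$ in the store with $y$ occurring in $s'$, or $r=x$, or $y=x$; or (3) $y\notin\Theta$ and there are a variable $z\in\Theta$ occurring in the store and $k\ge0$ with $y$ occurring in $\Theta^z(k)$. Finally, syntactic first-order unification is run on the union of the store and active set, and the procedure fails if it fails (clash or occurs check). *)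

theory Defs
  imports "HOL-Library.Countable" "HOL-Library.Infinite_Typeclass"
begin

datatype ('f, vars: 'x) trm = Var 'x | Fun 'f "('f, 'x) trm list"

primrec subst :: "('x \<Rightarrow> ('f, 'y) trm) \<Rightarrow> ('f, 'x) trm \<Rightarrow> ('f, 'y) trm" where
  "subst \<sigma> (Var x) = \<sigma> x"
| "subst \<sigma> (Fun f ts) = Fun f (map (subst \<sigma>) ts)"

text \<open>A signature is a partial map from function symbols to arities.\<close>

inductive wf_trm :: "('f \<rightharpoonup> nat) \<Rightarrow> ('f, 'x) trm \<Rightarrow> bool" for \<Sigma> where
  "wf_trm \<Sigma> (Var x)"
| "\<lbrakk>\<Sigma> f = Some (length ts); \<And>t. t \<in> set ts \<Longrightarrow> wf_trm \<Sigma> t\<rbrakk> \<Longrightarrow> wf_trm \<Sigma> (Fun f ts)"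

text \<open>The pair \<open>(X, i)\<close> is the variable \<open>X\<^sub>i\<close>; the pair \<open>(s, t)\<close> of terms is the
  (ordered) equation between \<open>s\<close> and \<open>t\<close>.\<close>

type_synonym 'v var = "'v \<times> nat"
type_synonym ('f, 'v) vtrm = "('f, 'v var) trm"
type_synonym ('f, 'x) eqn = "('f, 'x) trm \<times> ('f, 'x) trm"

definition cls :: "'v var \<Rightarrow> 'v set" where
  "cls x = {fst x}"

definition shift :: "nat \<Rightarrow> ('f, 'v) vtrm \<Rightarrow> ('f, 'v) vtrm" where
  "shift d = subst (\<lambda>(X, i). Var (X, i + d))"

definition eqn_vars :: "('f, 'x) eqn \<Rightarrow> 'x set" where
  "eqn_vars e = vars (fst e) \<union> vars (snd e)"

definition wf_eqn :: "('f \<rightharpoonup> nat) \<Rightarrow> ('f, 'x) eqn \<Rightarrow> bool" where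
  "wf_eqn \<Sigma> e \<longleftrightarrow> wf_trm \<Sigma> (fst e) \<and> wf_trm \<Sigma> (snd e)"


section \<open>Substitution schemata\<close>

text \<open>The list \<open>[(X\<^sup>1, t\<^sub>1), \<dots>, (X\<^sup>n, t\<^sub>n)]\<close> presents the schema mapping \<open>X\<^sup>i\<^sub>j\<close> to
  \<open>shift j t\<^sub>i\<close> for all \<open>j\<close>.\<close>

type_synonym ('f, 'v) schema = "('v \<times> ('f, 'v) vtrm) list"

definition is_schema :: "('f \<rightharpoonup> nat) \<Rightarrow> ('f, 'v) schema \<Rightarrow> bool" where
  "is_schema \<Sigma> \<Theta> \<longleftrightarrow> distinct (map fst \<Theta>) \<and> (\<forall>t \<in> snd ` set \<Theta>. wf_trm \<Sigma> t)"

definition schema_dom :: "('f, 'v) schema \<Rightarrow> 'v set" where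
  "schema_dom \<Theta> = fst ` set \<Theta>"

definition in_schema :: "'v var \<Rightarrow> ('f, 'v) schema \<Rightarrow> bool" where
  "in_schema x \<Theta> \<longleftrightarrow> cls x \<subseteq> schema_dom \<Theta>"

definition schema_image :: "('f, 'v) schema \<Rightarrow> 'v var \<Rightarrow> ('f, 'v) vtrm" where
  "schema_image \<Theta> x = shift (snd x) (the (map_of \<Theta> (fst x)))"

definition schema_subst ::
    "('f, 'v) schema \<Rightarrow> ('f, 'v) vtrm \<Rightarrow> 'v var \<Rightarrow> ('f, 'v) vtrm" where
  "schema_subst \<Theta> t x = (if x \<in> vars t \<and> in_schema x \<Theta> then schema_image \<Theta> x else Var x)"

primrec schema_iter :: "('f, 'v) schema \<Rightarrow> ('f, 'v) vtrm \<Rightarrow> nat \<Rightarrow> ('f, 'v) vtrm" where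
  "schema_iter \<Theta> t 0 = t"
| "schema_iter \<Theta> t (Suc k) =
    (let s = schema_iter \<Theta> t k in subst (schema_subst \<Theta> s) s)"


section \<open>The rules\<close>

text \<open>\<open>sat_rule U R A\<close>: on the active set \<open>U\<close> there is a rule instance that removes the
  equations \<open>R\<close> and adds the equations \<open>A\<close>.\<close>

inductive sat_rule ::
    "('f, 'x) eqn set \<Rightarrow> ('f, 'x) eqn set \<Rightarrow> ('f, 'x) eqn set \<Rightarrow> bool" for U where
  decomposition:
    "\<lbrakk>(Fun f rs, Fun f ss) \<in> U; length rs = length ss\<rbrakk>
      \<Longrightarrow> sat_rule U {(Fun f rs, Fun f ss)} (set (zip rs ss))"
| orient1:
    "\<lbrakk>(r, Var x) \<in> U; \<nexists>y. r = Var y\<rbrakk> \<Longrightarrow> sat_rule U {(r, Var x)} {(Var x, r)}"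
| orient2:
    "\<lbrakk>(Var y, Var x) \<in> U; (Var x, Var y) \<notin> U\<rbrakk> \<Longrightarrow> sat_rule U {} {(Var x, Var y)}"
| transitivity:
    "\<lbrakk>(Var x, r) \<in> U; (Var x, s) \<in> U; r \<noteq> s\<rbrakk> \<Longrightarrow> sat_rule U {} {(r, s)}"
| reflexive:
    "(t, t) \<in> U \<Longrightarrow> sat_rule U {(t, t)} {}"

text \<open>An instance that adds equations is applied only if one of them is new, that is, outside
  the set \<open>H\<close> of all equations that have been active so far. Comparing with the current active
  set only would admit infinite runs: on \<open>{y = f(c,a), y = f(c,b)}\<close> Transitivity adds
  \<open>f(c,a) = f(c,b)\<close>, Decomposition replaces it by \<open>c = c\<close> and \<open>a = b\<close>, Reflexive removes
  \<open>c = c\<close>, and Transitivity and Decomposition can start over.\<close>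

definition sat_instance ::
    "('f, 'x) eqn set \<Rightarrow> ('f, 'x) eqn set \<Rightarrow> ('f, 'x) eqn set \<Rightarrow> ('f, 'x) eqn set \<Rightarrow> bool" where
  "sat_instance H U R A \<longleftrightarrow> sat_rule U R A \<and> (A \<noteq> {} \<longrightarrow> \<not> A \<subseteq> H)"

definition has_clash :: "('f, 'x) eqn set \<Rightarrow> bool" where
  "has_clash U \<longleftrightarrow> (\<exists>f g rs ss. (Fun f rs, Fun g ss) \<in> U \<and> f \<noteq> g)"

text \<open>\<open>storable \<Theta> S y r\<close>: relative to the store \<open>S\<close>, Store may move the equation between
  the variable \<open>y\<close> and \<open>r\<close>.\<close>

inductive storable ::
    "('f, 'v) schema \<Rightarrow> ('f, 'v var) eqn set \<Rightarrow> 'v var \<Rightarrow> ('f, 'v) vtrm \<Rightarrow> bool"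
  for \<Theta> S y r where
  "\<lbrakk>in_schema y \<Theta>; \<And>x. r = Var x \<Longrightarrow> in_schema x \<Theta>\<rbrakk> \<Longrightarrow> storable \<Theta> S y r"
| "\<lbrakk>\<not> in_schema y \<Theta>; (Var x, s') \<in> S; y \<in> vars s' \<or> r = Var x \<or> y = x\<rbrakk>
    \<Longrightarrow> storable \<Theta> S y r"
| "\<lbrakk>\<not> in_schema y \<Theta>; in_schema z \<Theta>; z \<in> (\<Union>e\<in>S. eqn_vars e);
    y \<in> vars (schema_iter \<Theta> (Var z) k)\<rbrakk> \<Longrightarrow> storable \<Theta> S y r"

text \<open>Syntactic first-order unification by the rules of Martelli and Montanari; the result
  \<open>None\<close> is failure.\<close>

inductive unify_step :: "('f, 'x) eqn set \<Rightarrow> ('f, 'x) eqn set option \<Rightarrow> bool" for E where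
  delete:
    "(t, t) \<in> E \<Longrightarrow> unify_step E (Some (E - {(t, t)}))"
| decompose:
    "\<lbrakk>(Fun f rs, Fun f ss) \<in> E; length rs = length ss\<rbrakk>
      \<Longrightarrow> unify_step E (Some ((E - {(Fun f rs, Fun f ss)}) \<union> set (zip rs ss)))"
| swap:
    "\<lbrakk>(r, Var x) \<in> E; \<nexists>y. r = Var y\<rbrakk>
      \<Longrightarrow> unify_step E (Some (insert (Var x, r) (E - {(r, Var x)})))"
| eliminate:
    "\<lbrakk>(Var x, t) \<in> E; x \<notin> vars t; x \<in> (\<Union>e \<in> E - {(Var x, t)}. eqn_vars e); \<sigma> = Var(x := t)\<rbrakk>
      \<Longrightarrow> unify_step E
        (Some (insert (Var x, t) (map_prod (subst \<sigma>) (subst \<sigma>) ` (E - {(Var x, t)}))))"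
| conflict:
    "has_clash E \<Longrightarrow> unify_step E None"
| occurs_check:
    "\<lbrakk>(Var x, t) \<in> E; x \<in> vars t; t \<noteq> Var x\<rbrakk> \<Longrightarrow> unify_step E None"


section \<open>The procedure\<close>

text \<open>A configuration \<open>(S, U)\<close> of store and active set is tagged with the phase; \<open>Saturating\<close>
  also carries the set of all equations that have been active so far as first argument.\<close>

datatype ('f, 'v) state =
    Saturating "('f, 'v var) eqn set" "('f, 'v var) eqn set" "('f, 'v var) eqn set"
  | Storing "('f, 'v var) eqn set" "('f, 'v var) eqn set"
  | Unifying "('f, 'v var) eqn set"
  | Success "('f, 'v var) eqn set"
  | Failure

inductive step :: "('f, 'v) schema \<Rightarrow> ('f, 'v) state \<Rightarrow> ('f, 'v) state \<Rightarrow> bool" for \<Theta> where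
  saturate:
    "sat_instance H U R A
      \<Longrightarrow> step \<Theta> (Saturating H S U) (Saturating (H \<union> A) S ((U - R) \<union> A))"
| clash:
    "has_clash U \<Longrightarrow> step \<Theta> (Saturating H S U) Failure"
| saturated:
    "\<lbrakk>\<nexists>R A. sat_instance H U R A; \<not> has_clash U\<rbrakk>
      \<Longrightarrow> step \<Theta> (Saturating H S U) (Storing S U)"
| store:
    "\<lbrakk>(Var y, r) \<in> U; storable \<Theta> S y r\<rbrakk>
      \<Longrightarrow> step \<Theta> (Storing S U) (Storing (insert (Var y, r) S) (U - {(Var y, r)}))"
| stored:
    "(\<nexists>y r. (Var y, r) \<in> U \<and> storable \<Theta> S y r) \<Longrightarrow> step \<Theta> (Storing S U) (Unifying (S \<union> U))"
| unify:
    "unify_step E (Some E') \<Longrightarrow> step \<Theta> (Unifying E) (Unifying E')"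
| unify_fail:
    "unify_step E None \<Longrightarrow> step \<Theta> (Unifying E) Failure"
| unified:
    "(\<nexists>res. unify_step E res) \<Longrightarrow> step \<Theta> (Unifying E) (Success E)"

definition initial :: "('f, 'v var) eqn set \<Rightarrow> ('f, 'v) state" where
  "initial U = Saturating U {} U"

text \<open>The procedure cannot get stuck except in an outcome.\<close>

lemma terminal_iff_outcome:
  "(\<nexists>c'. step \<Theta> c c') \<longleftrightarrow> c = Failure \<or> (\<exists>E. c = Success E)"
proof (cases c)
  case (Saturating H S U)
  then show ?thesis by (metis step.saturate step.clash step.saturated state.distinct)
next
  case (Storing S U)
  then show ?thesis by (metis step.store step.stored state.distinct)
next
  case (Unifying E)
  then show ?thesis
    by (metis step.unify step.unify_fail step.unified option.exhaust state.distinct)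
qed (auto elim: step.cases)

end

theory Submission
  imports Defs
begin

text \<open>Each phase decreases a well-founded measure. Saturation only ever produces equations
  between subterms of the input, so the set of equations seen so far can grow only finitely often,
  and an instance that adds nothing shrinks the active set. Storing shrinks the active set. For
  syntactic unification, the triple of the number of unsolved variables, the total size and the
  number of wrongly oriented equations decreases lexicographically.\<close>

text \<open>Induction on accessibility: the tail of an infinite run from \<open>x\<close> is an
  infinite run from a successor of \<open>x\<close>.\<close>

lemma no_infinite_chain_if_accp:
  assumes "Wellfounded.accp (\<lambda>b a. r a b) x"
  shows "\<nexists>c. c 0 = x \<and> (\<forall>i::nat. r (c i) (c (Suc i)))"
  using assms
proof (induction rule: accp.induct)
  case (accI x)
  show ?case
  proof
    assume "\<exists>c. c 0 = x \<and> (\<forall>i::nat. r (c i) (c (Suc i)))"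
    then obtain c where c: "c 0 = x" "\<forall>i::nat. r (c i) (c (Suc i))" by blast
    then have "r x (c (Suc 0))" by metis
    moreover have "\<forall>i. r (c (Suc i)) (c (Suc (Suc i)))" using c(2) by blast
    ultimately show False using accI.IH[of "c (Suc 0)"]
      by (auto dest: spec[of _ "\<lambda>i. c (Suc i)"])
  qed
qed

section \<open>Syntactic unification\<close>

definition eqns_vars :: "('f, 'x) eqn set \<Rightarrow> 'x set" where
  "eqns_vars E = (\<Union>e\<in>E. eqn_vars e)"

definition solved_by :: "('f, 'x) eqn set \<Rightarrow> 'x \<Rightarrow> ('f, 'x) trm \<Rightarrow> bool" where
  "solved_by E x t \<longleftrightarrow> (Var x, t) \<in> E \<and> x \<notin> vars t \<and> x \<notin> eqns_vars (E - {(Var x, t)})"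

text \<open>Elimination keeps \<open>(Var x, t)\<close>, so \<open>x\<close> does not disappear from
  the equations; it only becomes solved.\<close>

definition unsolved :: "('f, 'x) eqn set \<Rightarrow> 'x set" where
  "unsolved E = eqns_vars E - {x. \<exists>t. solved_by E x t}"

text \<open>The \<open>Suc\<close> gives every equation positive weight, so that deleting one always
  lowers the sum.\<close>

definition eqn_size :: "('f, 'x) eqn \<Rightarrow> nat" where
  "eqn_size e = Suc (size (fst e) + size (snd e))"

definition misoriented :: "('f, 'x) eqn set \<Rightarrow> ('f, 'x) eqn set" where
  "misoriented E = {(r, t) \<in> E. (\<nexists>y. r = Var y) \<and> (\<exists>x. t = Var x)}"

lemma finite_vars: "finite (vars t)"
  by (induction t) auto

lemma finite_unsolved: "finite E \<Longrightarrow> finite (unsolved E)"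
  by (auto simp: unsolved_def eqns_vars_def eqn_vars_def finite_vars)

lemma vars_subst: "vars (subst \<sigma> t) = (\<Union>x\<in>vars t. vars (\<sigma> x))"
  by (induction t) auto

lemma vars_subst_upd:
  "vars (subst (Var(x := t)) s) = (vars s - {x}) \<union> (if x \<in> vars s then vars t else {})"
  by (auto simp: vars_subst split: if_splits)

lemma eqn_vars_subst_upd:
  "eqn_vars (map_prod (subst (Var(x := t))) (subst (Var(x := t))) e)
    = (eqn_vars e - {x}) \<union> (if x \<in> eqn_vars e then vars t else {})"
  by (auto simp: eqn_vars_def vars_subst_upd)

text \<open>Covers deletion, decomposition and swapping. The second hypothesis keeps
  \<open>e\<close> from being a solving equation, so a solved variable occurs neither in
  \<open>e\<close> nor in \<open>A\<close> and stays solved.\<close>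

lemma unsolved_replace_subset:
  assumes e: "e \<in> E" "\<And>x t. e = (Var x, t) \<Longrightarrow> x \<in> vars t"
    and A: "eqns_vars A \<subseteq> eqn_vars e"
  shows "unsolved ((E - {e}) \<union> A) \<subseteq> unsolved E"
proof -
  have "solved_by ((E - {e}) \<union> A) x t" if s: "solved_by E x t" for x t
  proof -
    have ne: "e \<noteq> (Var x, t)" using e(2) s by (auto simp: solved_by_def)
    then have "x \<notin> eqn_vars e" using s e(1) by (auto simp: solved_by_def eqns_vars_def)
    then have "x \<notin> eqns_vars A" using A by blast
    then show ?thesis using s ne by (auto simp: solved_by_def eqns_vars_def)
  qed
  moreover have "eqns_vars ((E - {e}) \<union> A) \<subseteq> eqns_vars E"
    using e(1) A by (auto simp: eqns_vars_def)
  ultimately show ?thesis by (auto simp: unsolved_def)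
qed

text \<open>The eliminated \<open>x\<close> becomes solved and was not solved before, since it
  occurs in a second equation. Any other solved variable stays solved, its right-hand side
  \<open>s\<close> turning into \<open>subst \<sigma> s\<close>.\<close>

lemma unsolved_eliminate_psubset:
  assumes e: "(Var x, t) \<in> E" "x \<notin> vars t" "x \<in> (\<Union>e \<in> E - {(Var x, t)}. eqn_vars e)"
    and \<sigma>: "\<sigma> = Var(x := t)"
  shows "unsolved (insert (Var x, t) (map_prod (subst \<sigma>) (subst \<sigma>) ` (E - {(Var x, t)})))
    \<subset> unsolved E" (is "unsolved ?E' \<subset> _")
proof -
  let ?f = "map_prod (subst \<sigma>) (subst \<sigma>)"
  have vf: "eqn_vars (?f e) = (eqn_vars e - {x}) \<union> (if x \<in> eqn_vars e then vars t else {})" for e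
    unfolding \<sigma> by (rule eqn_vars_subst_upd)
  have vx: "eqn_vars (Var x, t) = insert x (vars t)" by (simp add: eqn_vars_def)
  have "eqns_vars ?E' \<subseteq> eqns_vars E"
    using e(1) vx by (fastforce simp: eqns_vars_def vf split: if_splits)
  moreover have "\<exists>s'. solved_by ?E' y s'" if s: "solved_by E y s" for y s
  proof -
    \<comment> \<open>If \<open>y\<close> were \<open>x\<close>, its solving equation could only be
      \<open>(Var x, t)\<close>, but \<open>x\<close> also occurs elsewhere in
      \<open>E\<close>.\<close>
    have yx: "y \<noteq> x"
    proof
      assume yx: "y = x"
      then have "s = t" using s e(1) vx by (force simp: solved_by_def eqns_vars_def)
      then show False using yx s e(3) by (auto simp: solved_by_def eqns_vars_def)
    qed
    \<comment> \<open>This is why replacing \<open>x\<close> by \<open>t\<close> cannot introduce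
      \<open>y\<close> anywhere.\<close>
    then have yt: "y \<notin> eqn_vars (Var x, t)"
      using s e(1) by (force simp: solved_by_def eqns_vars_def)
    have fy: "?f (Var y, s) = (Var y, subst \<sigma> s)" using yx by (simp add: \<sigma>)
    moreover have "(Var y, s) \<in> E - {(Var x, t)}" using s yx by (auto simp: solved_by_def)
    ultimately have "(Var y, subst \<sigma> s) \<in> ?E'" by (intro insertI2) (rule image_eqI[OF sym])
    moreover have "y \<notin> vars (subst \<sigma> s)"
      using s yt by (auto simp: solved_by_def \<sigma> vars_subst_upd vx)
    moreover have "y \<notin> eqn_vars e'" if e': "e' \<in> ?E' - {(Var y, subst \<sigma> s)}" for e'
    proof (cases "e' = (Var x, t)")
      case False
      then have "e' \<in> ?f ` (E - {(Var x, t)})" using e' by blast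
      then obtain d where d: "d \<in> E" "e' = ?f d" by (elim imageE DiffE)
      \<comment> \<open>Distinct equations may coincide after substitution, but the preimage of an
        equation other than the new solving one is not the old solving one.\<close>
      have "d \<noteq> (Var y, s)" using e' fy d(2) by blast
      then have "y \<notin> eqn_vars d" using d(1) s by (auto simp: solved_by_def eqns_vars_def)
      then show ?thesis using yt unfolding d(2) vf vx by simp
    qed (use yt in simp)
    ultimately have "solved_by ?E' y (subst \<sigma> s)" by (auto simp: solved_by_def eqns_vars_def)
    then show ?thesis ..
  qed
  moreover have "solved_by ?E' x t"
  proof -
    have "x \<notin> eqn_vars (?f d)" for d using e(2) by (auto simp: vf)
    then show ?thesis using e(2) by (auto simp: solved_by_def eqns_vars_def)
  qed
  moreover have "x \<in> unsolved E"
  proof -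
    have "\<not> solved_by E x s" for s
    proof
      assume s: "solved_by E x s"
      then have "s = t" using e(1) vx by (force simp: solved_by_def eqns_vars_def)
      then show False using s e(3) by (auto simp: solved_by_def eqns_vars_def)
    qed
    then show ?thesis using e(3) by (auto simp: unsolved_def eqns_vars_def)
  qed
  ultimately show ?thesis unfolding unsolved_def by blast
qed

section \<open>Total size when equations are replaced\<close>

lemma sum_Un_le:
  fixes f :: "'a \<Rightarrow> nat"
  shows "finite A \<Longrightarrow> finite B \<Longrightarrow> sum f (A \<union> B) \<le> sum f A + sum f B"
  using sum.union_inter[of A B f] by simp

lemma sum_replace_le:
  fixes f :: "'a \<Rightarrow> nat"
  assumes "finite E" "finite A" "e \<in> E"
  shows "sum f ((E - {e}) \<union> A) + f e \<le> sum f E + sum f A"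
proof -
  have "sum f ((E - {e}) \<union> A) \<le> sum f (E - {e}) + sum f A"
    by (rule sum_Un_le) (use assms in auto)
  moreover have "sum f E = f e + sum f (E - {e})" using assms by (simp add: sum.remove)
  ultimately show ?thesis by simp
qed

text \<open>\<open>size_list\<close> adds one per list cell, which pays for the \<open>Suc\<close>
  in \<open>eqn_size\<close>; repeated pairs collapse in the set and only lower the sum.\<close>

lemma sum_eqn_size_zip_le:
  "length rs = length ss
    \<Longrightarrow> (\<Sum>e\<in>set (zip rs ss). eqn_size e) \<le> size_list size rs + size_list size ss"
proof (induction rs ss rule: list_induct2)
  case (Cons r rs s ss)
  have "(\<Sum>e\<in>set (zip (r # rs) (s # ss)). eqn_size e)
      \<le> eqn_size (r, s) + (\<Sum>e\<in>set (zip rs ss). eqn_size e)"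
    by (simp add: sum.insert_if)
  then show ?case using Cons.IH by (simp add: eqn_size_def)
qed simp

lemma eqns_vars_zip_subset: "eqns_vars (set (zip rs ss)) \<subseteq> eqn_vars (Fun f rs, Fun g ss)"
  by (fastforce simp: eqns_vars_def eqn_vars_def dest: set_zip_leftD set_zip_rightD)

text \<open>Elimination lowers the first component but may increase sizes; deletion and
  decomposition lower the second, though decomposition may create misoriented equations; swapping
  lowers the third.\<close>

definition unify_measure :: "(('f, 'x) eqn set \<times> ('f, 'x) eqn set) set" where
  "unify_measure = measures [card \<circ> unsolved, sum eqn_size, card \<circ> misoriented]"

lemma wf_unify_measure: "wf unify_measure"
  by (simp add: unify_measure_def)

lemma unify_step_finite: "unify_step E (Some E') \<Longrightarrow> finite E \<Longrightarrow> finite E'"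
  by (erule unify_step.cases) auto

lemma unify_step_decreases:
  assumes step: "unify_step E (Some E')" and fin: "finite E"
  shows "(E', E) \<in> unify_measure"
proof -
  have by_unsolved: "(E', E) \<in> unify_measure" if "unsolved E' \<subset> unsolved E"
    using psubset_card_mono[OF finite_unsolved[OF fin] that] by (simp add: unify_measure_def)
  have by_size: "(E', E) \<in> unify_measure"
    if "unsolved E' \<subseteq> unsolved E" "sum eqn_size E' < sum eqn_size E"
    using card_mono[OF finite_unsolved[OF fin] that(1)] that(2)
    by (auto simp: unify_measure_def)
  have by_misoriented: "(E', E) \<in> unify_measure"
    if "unsolved E' \<subseteq> unsolved E" "sum eqn_size E' \<le> sum eqn_size E"
      "misoriented E' \<subset> misoriented E"
  proof -
    have "finite (misoriented E)"
      by (rule finite_subset[OF _ fin]) (auto simp: misoriented_def)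
    then have "card (misoriented E') < card (misoriented E)"
      using that(3) psubset_card_mono by blast
    moreover have "card (unsolved E') \<le> card (unsolved E)"
      using card_mono[OF finite_unsolved[OF fin] that(1)] .
    ultimately show ?thesis using that(2) by (auto simp: unify_measure_def)
  qed
  from step show ?thesis
  proof cases
    case (delete t)
    \<comment> \<open>The empty union brings deletion into the form of a replacement.\<close>
    have "unsolved (E - {(t, t)} \<union> {}) \<subseteq> unsolved E"
      by (rule unsolved_replace_subset) (use delete in \<open>auto simp: eqns_vars_def\<close>)
    moreover have "sum eqn_size (E - {(t, t)} \<union> {}) + eqn_size (t, t) \<le> sum eqn_size E + 0"
      using sum_replace_le[OF fin, of "{}" "(t, t)" eqn_size] delete by simp
    ultimately show ?thesis using delete by (intro by_size) (auto simp: eqn_size_def)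
  next
    case (decompose f rs ss)
    have "unsolved (E - {(Fun f rs, Fun f ss)} \<union> set (zip rs ss)) \<subseteq> unsolved E"
      by (rule unsolved_replace_subset) (use decompose eqns_vars_zip_subset[of rs ss f f] in auto)
    moreover have "sum eqn_size (E - {(Fun f rs, Fun f ss)} \<union> set (zip rs ss))
        + eqn_size (Fun f rs, Fun f ss) \<le> sum eqn_size E + sum eqn_size (set (zip rs ss))"
      by (rule sum_replace_le) (use fin decompose in auto)
    moreover have "sum eqn_size (set (zip rs ss)) < eqn_size (Fun f rs, Fun f ss)"
      using sum_eqn_size_zip_le[OF \<open>length rs = length ss\<close>] by (simp add: eqn_size_def)
    ultimately show ?thesis using decompose by (intro by_size) auto
  next
    case (swap r x)
    have E': "E' = E - {(r, Var x)} \<union> {(Var x, r)}" using swap by auto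
    have "unsolved E' \<subseteq> unsolved E"
      unfolding E'
      by (rule unsolved_replace_subset) (use swap in \<open>auto simp: eqns_vars_def eqn_vars_def\<close>)
    \<comment> \<open>Both orientations have the same size; the sum drops if the flipped equation
      was already in \<open>E\<close>.\<close>
    moreover have "sum eqn_size E' \<le> sum eqn_size E"
      using sum_replace_le[OF fin, of "{(Var x, r)}" "(r, Var x)" eqn_size] swap
      by (simp add: E' eqn_size_def)
    moreover have "misoriented E' \<subset> misoriented E"
      using swap(2,3) unfolding E' misoriented_def by auto
    ultimately show ?thesis by (rule by_misoriented)
  next
    case (eliminate x t \<sigma>)
    show ?thesis
      by (rule by_unsolved, unfold \<open>E' = _\<close>, rule unsolved_eliminate_psubset) (fact eliminate)+
  qed
qed

section \<open>The three phases\<close>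

text \<open>Accessibility of single states, because infinite sets of equations admit infinite runs.
  Phases only move forward, so they are treated from the last to the first.\<close>

abbreviation terminating :: "('f, 'v) schema \<Rightarrow> ('f, 'v) state \<Rightarrow> bool" where
  "terminating \<Theta> \<equiv> Wellfounded.accp (\<lambda>c' c. step \<Theta> c c')"

lemma terminating_Failure: "terminating \<Theta> Failure"
  by (rule accp.accI) (auto elim: step.cases)

lemma terminating_Success: "terminating \<Theta> (Success E)"
  by (rule accp.accI) (auto elim: step.cases)

lemma terminating_Unifying: "finite E \<Longrightarrow> terminating \<Theta> (Unifying E)"
proof (induction E rule: wf_induct_rule[OF wf_unify_measure])
  case (1 E)
  show ?case
  proof (rule accp.accI)
    fix c' assume "step \<Theta> (Unifying E) c'"
    then show "terminating \<Theta> c'"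
    proof cases
      case (unify E')
      then show ?thesis using 1 unify_step_decreases unify_step_finite by blast
    qed (auto simp: terminating_Failure terminating_Success)
  qed
qed

lemma terminating_Storing: "finite U \<Longrightarrow> finite S \<Longrightarrow> terminating \<Theta> (Storing S U)"
proof (induction U arbitrary: S rule: finite_psubset_induct)
  case (psubset U)
  show ?case
  proof (rule accp.accI)
    fix c' assume "step \<Theta> (Storing S U) c'"
    then show "terminating \<Theta> c'"
    proof cases
      case (store y r)
      then have "U - {(Var y, r)} \<subset> U" by blast
      then show ?thesis using psubset.IH psubset.prems store(1) by simp
    next
      case stored
      then show ?thesis using psubset.hyps psubset.prems by (simp add: terminating_Unifying)
    qed
  qed
qed

section \<open>Saturation within a finite subterm-closed set of terms\<close>

definition subterm_closed :: "('f, 'x) trm set \<Rightarrow> bool" where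
  "subterm_closed T \<longleftrightarrow> (\<forall>f ts. Fun f ts \<in> T \<longrightarrow> set ts \<subseteq> T)"

lemma subterm_closed_UN: "(\<And>a. a \<in> A \<Longrightarrow> subterm_closed (F a)) \<Longrightarrow> subterm_closed (\<Union>a\<in>A. F a)"
  by (fastforce simp: subterm_closed_def)

text \<open>Passes from single terms to finite sets; serves both the argument list of a
  \<open>Fun\<close> and the whole input.\<close>

lemma finite_subterm_closed_superset_UN:
  assumes "finite A" "\<And>t. t \<in> A \<Longrightarrow> \<exists>T. finite T \<and> t \<in> T \<and> subterm_closed T"
  shows "\<exists>T. finite T \<and> A \<subseteq> T \<and> subterm_closed T"
proof -
  obtain F where "\<And>t. t \<in> A \<Longrightarrow> finite (F t) \<and> t \<in> F t \<and> subterm_closed (F t)"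
    using assms(2) by metis
  then show ?thesis
    using assms(1) subterm_closed_UN[of A F] by (intro exI[of _ "\<Union>t\<in>A. F t"]) auto
qed

lemma finite_subterm_closed_superset:
  assumes "finite A"
  shows "\<exists>T. finite T \<and> A \<subseteq> T \<and> subterm_closed T"
proof (rule finite_subterm_closed_superset_UN[OF assms])
  fix t :: "('a, 'b) trm"
  show "\<exists>T. finite T \<and> t \<in> T \<and> subterm_closed T"
  proof (induction t)
    case (Var x)
    then show ?case by (intro exI[of _ "{Var x}"]) (simp add: subterm_closed_def)
  next
    case (Fun f ts)
    then obtain T where "finite T" "set ts \<subseteq> T" "subterm_closed T"
      using finite_subterm_closed_superset_UN[of "set ts"] by auto
    then show ?case
      by (intro exI[of _ "insert (Fun f ts) T"]) (auto simp: subterm_closed_def)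
  qed
qed

text \<open>Decomposition passes to arguments; every other rule only recombines sides of present
  equations.\<close>

lemma sat_rule_subterm_closed:
  assumes "sat_rule U R A" "U \<subseteq> T \<times> T" "subterm_closed T"
  shows "A \<subseteq> T \<times> T"
  using assms
proof cases
  case (decomposition f rs ss)
  then have "set rs \<subseteq> T" "set ss \<subseteq> T" using assms by (auto simp: subterm_closed_def)
  then show ?thesis using decomposition by (auto dest: set_zip_leftD set_zip_rightD)
qed auto

text \<open>Only Reflexive and the decomposition of empty argument lists add nothing, and both
  remove a member of \<open>U\<close>.\<close>

lemma sat_rule_removes: "sat_rule U R {} \<Longrightarrow> U - R \<subset> U"
  by (erule sat_rule.cases) auto

text \<open>Lexicographic descent on the number of pairs in \<open>T \<times> T\<close> not yet
  seen, then on the size of the active set.\<close>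

lemma terminating_Saturating:
  assumes T: "finite T" "subterm_closed T" and S: "finite S"
  shows "H \<subseteq> T \<times> T \<Longrightarrow> U \<subseteq> H \<Longrightarrow> terminating \<Theta> (Saturating H S U)"
proof (induction "(H, U)" arbitrary: H U
    rule: wf_induct_rule[OF wf_measures[of "[\<lambda>(H, U). card (T \<times> T - H), \<lambda>(H, U). card U]"]])
  case (1 H U)
  have finU: "finite U" using 1(2,3) T(1) by (meson finite_SigmaI finite_subset)
  show ?case
  proof (rule accp.accI)
    fix c' assume "step \<Theta> (Saturating H S U) c'"
    then show "terminating \<Theta> c'"
    proof cases
      case (saturate R A)
      have A: "A \<subseteq> T \<times> T"
        using saturate(2) 1(2,3) T(2) sat_rule_subterm_closed by (metis sat_instance_def subset_trans)
      have "((H \<union> A, U - R \<union> A), (H, U)) \<in>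
        measures [\<lambda>(H, U). card (T \<times> T - H), \<lambda>(H, U). card U]"
      proof (cases "A = {}")
        case True
        then have "U - R \<subset> U" using saturate(2) sat_rule_removes by (auto simp: sat_instance_def)
        then show ?thesis using True psubset_card_mono[OF finU] by simp
      next
        case False
        \<comment> \<open>The side condition of \<open>sat_instance\<close> supplies an equation of
          \<open>A\<close> outside the history \<open>H\<close>.\<close>
        then have "T \<times> T - (H \<union> A) \<subset> T \<times> T - H"
          using saturate(2) A by (auto simp: sat_instance_def)
        then show ?thesis using T(1) by (simp add: psubset_card_mono)
      qed
      then show ?thesis using 1 A saturate(1) by blast
    next
      case saturated
      then show ?thesis using finU S by (simp add: terminating_Storing)
    qed (simp add: terminating_Failure)
  qed
qed

theorem theorem2:
  fixes \<Sigma> :: "'f \<rightharpoonup> nat"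
    and \<Theta> :: "('f, 'v::{countable,infinite}) schema"
    and U :: "('f, 'v var) eqn set"
  assumes "is_schema \<Sigma> \<Theta>"
    and "finite U"
    and "\<forall>e\<in>U. wf_eqn \<Sigma> e"
  shows "\<nexists>c. c 0 = initial U \<and> (\<forall>i::nat. step \<Theta> (c i) (c (Suc i)))"
proof -
  \<comment> \<open>\<open>T\<close> is built from all sides of the input equations; since the
    history starts as \<open>U\<close>, it lies in \<open>T \<times> T\<close>.\<close>
  obtain T where T: "finite T" "fst ` U \<union> snd ` U \<subseteq> T" "subterm_closed T"
    using finite_subterm_closed_superset[of "fst ` U \<union> snd ` U"] \<open>finite U\<close> by auto
  then have "U \<subseteq> T \<times> T" by force
  then have "terminating \<Theta> (initial U)"
    unfolding initial_def using T by (intro terminating_Saturating) auto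
  then show ?thesis by (rule no_infinite_chain_if_accp)
qed

end
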